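(* Let $n\geq 2$ be an integer. Then the following hold. (1) If $n$ is even, then $$\mathrm{S}_{\mathrm{Dic}_{4n}}(2)=4n(n-2),\qquad \mathrm{D}_{\mathrm{Dic}_{4n}}(2)=0,\qquad \mathrm{B}_{\mathrm{Dic}_{4n}}(2)=2n(2n+3).$$ (2) If $n$ is odd, then $$\mathrm{S}_{\mathrm{Dic}_{4n}}(2)=4n(n-1),\qquad \mathrm{D}_{\mathrm{Dic}_{4n}}(2)=0,\qquad \mathrm{B}_{\mathrm{Dic}_{4n}}(2)=2n(2n+1).$$
   Context: For a positive integer $n$, the dicyclic group is $\mathrm{Dic}_{4n}=\langle a,b : a^{2n}=1,\ a^{n}=b^2,\ b^{-1}ab=a^{-1}\rangle$, a group of order $4n$ with elements $1,a,\dots,a^{2n-1},b,ab,\dots,a^{2n-1}b$. For a subset $A$ of a finite (multiplicatively written) group, put $A+A=\{a_1a_2: a_1,a_2\in A\}$ and $A-A=\{a_1a_2^{-1}: a_1,a_2\in A\}$. The set $A$ is MSTD if $|A+A|>|A-A|$, balanced if $|A+A|=|A-A|$, and MDTS if $|A+A|<|A-A|$. For $k\in\mathbb{N}$, $\mathrm{S}_{\mathrm{Dic}_{4n}}(k)$, $\mathrm{D}_{\mathrm{Dic}_{4n}}(k)$, $\mathrm{B}_{\mathrm{Dic}_{4n}}(k)$ denote the numbers of MSTD, MDTS, and balanced subsets of $\mathrm{Dic}_{4n}$ of cardinality $k$, respectively. *)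

theory Defs
  imports "HOL-Algebra.Coset"
begin

datatype 'x letter = Gen 'x | GenInv 'x

type_synonym 'x word = "'x letter list"

fun letter_inv :: "'x letter \<Rightarrow> 'x letter" where
  "letter_inv (Gen x) = GenInv x"
| "letter_inv (GenInv x) = Gen x"

text \<open>The least congruence on words that contains the relations \<open>R\<close> (a pair \<open>(u, v)\<close> in \<open>R\<close>
  stands for the relation \<open>u = v\<close>) and cancels a letter against its inverse. Its quotient is
  the free group modulo the normal closure of the relators \<open>u v\<^sup>-\<^sup>1\<close>.\<close>

inductive pres_eq :: "('x word \<times> 'x word) set \<Rightarrow> 'x word \<Rightarrow> 'x word \<Rightarrow> bool"
  for R :: "('x word \<times> 'x word) set" where
  rel: "(u, v) \<in> R \<Longrightarrow> pres_eq R u v"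
| cancel: "pres_eq R [l, letter_inv l] []"
| refl: "pres_eq R u u"
| sym: "pres_eq R u v \<Longrightarrow> pres_eq R v u"
| trans: "pres_eq R u v \<Longrightarrow> pres_eq R v w \<Longrightarrow> pres_eq R u w"
| append: "pres_eq R u u' \<Longrightarrow> pres_eq R v v' \<Longrightarrow> pres_eq R (u @ v) (u' @ v')"

definition word_class :: "('x word \<times> 'x word) set \<Rightarrow> 'x word \<Rightarrow> 'x word set" where
  "word_class R u = {v. pres_eq R u v}"

definition presented_group :: "('x word \<times> 'x word) set \<Rightarrow> 'x word set monoid" where
  "presented_group R =
    \<lparr>carrier = range (word_class R),
     mult = (\<lambda>X Y. \<Union>u\<in>X. \<Union>v\<in>Y. word_class R (u @ v)),
     one = word_class R []\<rparr>"

lemma word_class_eq_iff: "word_class R u = word_class R v \<longleftrightarrow> pres_eq R u v"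
proof
  assume "word_class R u = word_class R v"
  then have "v \<in> word_class R u" by (simp add: word_class_def pres_eq.refl)
  then show "pres_eq R u v" by (simp add: word_class_def)
next
  assume "pres_eq R u v"
  then show "word_class R u = word_class R v"
    unfolding word_class_def by (blast intro: pres_eq.sym pres_eq.trans)
qed

lemma mult_word_class:
  "word_class R u \<otimes>\<^bsub>presented_group R\<^esub> word_class R v = word_class R (u @ v)"
proof -
  have "word_class R (u' @ v') = word_class R (u @ v)"
    if "u' \<in> word_class R u" "v' \<in> word_class R v" for u' v'
  proof -
    from that have "pres_eq R (u @ v) (u' @ v')"
      by (simp add: word_class_def pres_eq.append)
    then show ?thesis by (simp add: word_class_eq_iff pres_eq.sym)
  qed
  moreover have "u \<in> word_class R u" "v \<in> word_class R v"
    by (simp_all add: word_class_def pres_eq.refl)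
  ultimately have "(\<Union>u'\<in>word_class R u. \<Union>v'\<in>word_class R v. word_class R (u' @ v'))
      = word_class R (u @ v)"
    by blast
  then show ?thesis
    by (simp add: presented_group_def)
qed

lemma pres_eq_left_inverse: "pres_eq R (rev (map letter_inv w) @ w) []"
proof (induction w)
  case Nil
  show ?case by (simp add: pres_eq.refl)
next
  case (Cons l w)
  have "letter_inv (letter_inv l) = l" by (cases l) auto
  then have "pres_eq R [letter_inv l, l] []"
    using pres_eq.cancel[of R "letter_inv l"] by simp
  then have "pres_eq R (rev (map letter_inv w) @ ([letter_inv l, l] @ w))
      (rev (map letter_inv w) @ ([] @ w))"
    by (intro pres_eq.append pres_eq.refl)
  then have "pres_eq R (rev (map letter_inv (l # w)) @ l # w) (rev (map letter_inv w) @ w)"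
    by simp
  then show ?case using Cons.IH by (rule pres_eq.trans)
qed

lemma group_presented_group: "group (presented_group R)"
proof (rule groupI)
  fix X assume "X \<in> carrier (presented_group R)"
  then obtain w where w: "X = word_class R w" by (auto simp: presented_group_def)
  have "word_class R (rev (map letter_inv w)) \<otimes>\<^bsub>presented_group R\<^esub> X = \<one>\<^bsub>presented_group R\<^esub>"
    unfolding w mult_word_class
    by (simp add: presented_group_def word_class_eq_iff pres_eq_left_inverse)
  then show "\<exists>Y\<in>carrier (presented_group R). Y \<otimes>\<^bsub>presented_group R\<^esub> X = \<one>\<^bsub>presented_group R\<^esub>"
    by (auto simp: presented_group_def)
next
  have car: "carrier (presented_group R) = range (word_class R)"
    and one: "\<one>\<^bsub>presented_group R\<^esub> = word_class R []"
    by (simp_all add: presented_group_def)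
  show "\<one>\<^bsub>presented_group R\<^esub> \<in> carrier (presented_group R)" by (simp add: car one)
  fix X assume X: "X \<in> carrier (presented_group R)"
  show "\<one>\<^bsub>presented_group R\<^esub> \<otimes>\<^bsub>presented_group R\<^esub> X = X"
    using X by (auto simp: car one mult_word_class)
  fix Y assume Y: "Y \<in> carrier (presented_group R)"
  show "X \<otimes>\<^bsub>presented_group R\<^esub> Y \<in> carrier (presented_group R)"
    using X Y by (auto simp: car mult_word_class)
  fix Z assume "Z \<in> carrier (presented_group R)"
  then show "X \<otimes>\<^bsub>presented_group R\<^esub> Y \<otimes>\<^bsub>presented_group R\<^esub> Z
      = X \<otimes>\<^bsub>presented_group R\<^esub> (Y \<otimes>\<^bsub>presented_group R\<^esub> Z)"
    using X Y by (auto simp: car mult_word_class)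
qed

datatype dic_gen = dic_a | dic_b

definition dicyclic_relations :: "nat \<Rightarrow> (dic_gen word \<times> dic_gen word) set" where
  "dicyclic_relations n =
    {(replicate (2 * n) (Gen dic_a), []),
     (replicate n (Gen dic_a), [Gen dic_b, Gen dic_b]),
     ([GenInv dic_b, Gen dic_a, Gen dic_b], [GenInv dic_a])}"

text \<open>The argument is \<open>n\<close>, not the group order \<open>4 n\<close>.\<close>

definition dicyclic_group :: "nat \<Rightarrow> dic_gen word set monoid" where
  "dicyclic_group n = presented_group (dicyclic_relations n)"

text \<open>The cardinalities below are meaningful only for finite \<open>G\<close>, since \<open>card\<close> of an infinite
  set is \<open>0\<close>.\<close>

definition sum_set :: "('a, 'b) monoid_scheme \<Rightarrow> 'a set \<Rightarrow> 'a set" where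
  "sum_set G A = A <#>\<^bsub>G\<^esub> A"

definition diff_set :: "('a, 'b) monoid_scheme \<Rightarrow> 'a set \<Rightarrow> 'a set" where
  "diff_set G A = A <#>\<^bsub>G\<^esub> (set_inv\<^bsub>G\<^esub> A)"

definition is_MSTD :: "('a, 'b) monoid_scheme \<Rightarrow> 'a set \<Rightarrow> bool" where
  "is_MSTD G A \<longleftrightarrow> card (sum_set G A) > card (diff_set G A)"

definition is_balanced :: "('a, 'b) monoid_scheme \<Rightarrow> 'a set \<Rightarrow> bool" where
  "is_balanced G A \<longleftrightarrow> card (sum_set G A) = card (diff_set G A)"

definition is_MDTS :: "('a, 'b) monoid_scheme \<Rightarrow> 'a set \<Rightarrow> bool" where
  "is_MDTS G A \<longleftrightarrow> card (sum_set G A) < card (diff_set G A)"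

definition num_MSTD :: "('a, 'b) monoid_scheme \<Rightarrow> nat \<Rightarrow> nat" where
  "num_MSTD G k = card {A. A \<subseteq> carrier G \<and> card A = k \<and> is_MSTD G A}"

definition num_MDTS :: "('a, 'b) monoid_scheme \<Rightarrow> nat \<Rightarrow> nat" where
  "num_MDTS G k = card {A. A \<subseteq> carrier G \<and> card A = k \<and> is_MDTS G A}"

definition num_balanced :: "('a, 'b) monoid_scheme \<Rightarrow> nat \<Rightarrow> nat" where
  "num_balanced G k = card {A. A \<subseteq> carrier G \<and> card A = k \<and> is_balanced G A}"

end

theory Submission imports Defs begin

text \<open>
  The set of products of \<open>A = {x, y}\<close> consists of \<open>x x\<close>, \<open>y y\<close>, \<open>x y\<close>, \<open>y x\<close>, and the set of
  quotients of \<open>1\<close>, \<open>x y\<^sup>-\<^sup>1\<close>, \<open>y x\<^sup>-\<^sup>1\<close>. A square \<open>x x\<close> or \<open>y y\<close> never equals a mixed product, and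
  \<open>1\<close> never equals a mixed quotient, so the two sizes are \<open>4 - P - Q\<close> and \<open>3 - R\<close>, where \<open>P\<close>,
  \<open>Q\<close>, \<open>R\<close> are \<open>1\<close> or \<open>0\<close> according to whether \<open>x y = y x\<close>, \<open>x x = y y\<close> and
  \<open>x y\<^sup>-\<^sup>1 = y x\<^sup>-\<^sup>1\<close> hold. Any two of these three coincidences imply the third
  (\<open>pair_coincidences\<close>). Going through the possibilities, in \<^emph>\<open>every\<close> group a pair is never MDTS,
  and it is MSTD precisely when \<open>x\<close> and \<open>y\<close> neither commute nor have the same square
  (\<open>is_MSTD_pair_iff\<close>). In a finite group the balanced pairs are therefore all the pairs that are
  not MSTD, and only the latter have to be counted.

  In the dicyclic group two powers of \<open>a\<close> commute, and every element \<open>a\<^sup>j b\<close> has square \<open>a\<^sup>n\<close>. So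
  an MSTD pair has the form \<open>{a\<^sup>i, a\<^sup>j b}\<close>. The two elements commute iff \<open>a\<^sup>2\<^sup>i = 1\<close>, that is
  \<open>i \<in> {0, n}\<close> modulo \<open>2 n\<close>, and they have the same square iff \<open>a\<^sup>2\<^sup>i = a\<^sup>n\<close>, that is, iff \<open>n\<close> is
  even and \<open>i \<in> {n / 2, 3 n / 2}\<close>. This leaves \<open>2 n - 4\<close> or \<open>2 n - 2\<close> values of \<open>i\<close>, according to
  the parity of \<open>n\<close>, and \<open>2 n\<close> values of \<open>j\<close>.

  The group is given by a presentation, so it remains to see that the \<open>4 n\<close> words \<open>a\<^sup>i\<close>, \<open>a\<^sup>i b\<close>
  represent distinct elements, that is, that the relations do not collapse the group. For this,
  words act on formal normal forms in the way in which the group should act on itself by left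
  multiplication; the defining relations act trivially (\<open>pres_eq_imp_word_act_cong\<close>), and the
  \<open>4 n\<close> words move the base point to distinct places.
\<close>

section \<open>Two-element subsets of an arbitrary group\<close>

context group
begin

lemma sum_set_pair:
  "sum_set G {x, y} = {x \<otimes> y, y \<otimes> x} \<union> {x \<otimes> x, y \<otimes> y}"
  by (auto simp: sum_set_def set_mult_def)

lemma diff_set_pair:
  assumes "x \<in> carrier G" "y \<in> carrier G"
  shows "diff_set G {x, y} = {\<one>, x \<otimes> inv y, y \<otimes> inv x}"
  using assms by (auto simp: diff_set_def set_mult_def SET_INV_def)

lemma card_sum_set_pair:
  assumes [simp]: "x \<in> carrier G" "y \<in> carrier G" and "x \<noteq> y"
  shows "card (sum_set G {x, y}) =
    (if x \<otimes> y = y \<otimes> x then 1 else 2) + (if x \<otimes> x = y \<otimes> y then 1 else 2)"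
proof -
  have "{x \<otimes> y, y \<otimes> x} \<inter> {x \<otimes> x, y \<otimes> y} = {}"
    using \<open>x \<noteq> y\<close> by auto
  then show ?thesis
    unfolding sum_set_pair by (subst card_Un_disjoint) auto
qed

lemma card_diff_set_pair:
  assumes [simp]: "x \<in> carrier G" "y \<in> carrier G" and "x \<noteq> y"
  shows "card (diff_set G {x, y}) = (if x \<otimes> inv y = y \<otimes> inv x then 2 else 3)"
proof -
  have "x \<otimes> inv y \<noteq> \<one>" "y \<otimes> inv x \<noteq> \<one>"
    using \<open>x \<noteq> y\<close> by (metis assms(1,2) inv_closed inv_equality inv_inv)+
  then show ?thesis
    by (auto simp: diff_set_pair)
qed

text \<open>Write \<open>x = d y\<close>. Then \<open>P\<close> says that \<open>d\<close> commutes with \<open>y\<close>, \<open>Q\<close> that \<open>d y d = y\<close>, and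
  \<open>R\<close> that \<open>d d = 1\<close>; in this form it is plain that any two of them give the third.\<close>

lemma pair_coincidences:
  assumes x: "x \<in> carrier G" and y: "y \<in> carrier G"
  defines "P \<equiv> x \<otimes> y = y \<otimes> x" and "Q \<equiv> x \<otimes> x = y \<otimes> y"
    and "R \<equiv> x \<otimes> inv y = y \<otimes> inv x"
  shows "P \<Longrightarrow> Q \<Longrightarrow> R" and "R \<Longrightarrow> P \<longleftrightarrow> Q"
proof -
  define d where "d = x \<otimes> inv y"
  have d [simp]: "d \<in> carrier G" using x y by (simp add: d_def)
  have x_eq: "x = d \<otimes> y" using x y by (simp add: d_def m_assoc)
  note [simp] = y
  have P: "P \<longleftrightarrow> d \<otimes> y = y \<otimes> d"
    unfolding P_def x_eq by (simp flip: m_assoc)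
  have Q: "Q \<longleftrightarrow> d \<otimes> (y \<otimes> d) = y"
    unfolding Q_def x_eq by (simp flip: m_assoc)
  have "y \<otimes> inv x = inv d" using x y by (simp add: d_def inv_mult_group)
  then have R: "R \<longleftrightarrow> d \<otimes> d = \<one>"
    unfolding R_def d_def[symmetric] by (metis d inv_equality r_inv)
  show R if P Q
  proof -
    have "d \<otimes> d \<otimes> y = \<one> \<otimes> y" using that P Q by (simp add: m_assoc)
    then show R unfolding R by (subst (asm) right_cancel) auto
  qed
  show "P \<longleftrightarrow> Q" if R
  proof -
    have dd: "d \<otimes> d = \<one>" using that R by simp
    have "d \<otimes> (y \<otimes> d) = y \<longleftrightarrow> d \<otimes> (d \<otimes> (y \<otimes> d)) = d \<otimes> y" by simp
    also have "d \<otimes> (d \<otimes> (y \<otimes> d)) = y \<otimes> d" using dd by (simp flip: m_assoc)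
    finally show ?thesis unfolding P Q by auto
  qed
qed

text \<open>By the preceding lemma, either none, exactly one, or all of the coincidences \<open>P\<close>, \<open>Q\<close>, \<open>R\<close>
  occur. With none the sizes are \<open>4\<close> and \<open>3\<close>, with only \<open>R\<close> they are \<open>4\<close> and \<open>2\<close>, with only \<open>P\<close> or
  only \<open>Q\<close> both are \<open>3\<close>, and with all three both are \<open>2\<close>.\<close>

lemma is_MSTD_pair_iff:
  assumes "x \<in> carrier G" "y \<in> carrier G" "x \<noteq> y"
  shows "is_MSTD G {x, y} \<longleftrightarrow> x \<otimes> y \<noteq> y \<otimes> x \<and> x \<otimes> x \<noteq> y \<otimes> y"
  using pair_coincidences[OF assms(1,2)]
  by (auto simp: is_MSTD_def card_sum_set_pair[OF assms] card_diff_set_pair[OF assms])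

lemma not_is_MDTS_pair:
  assumes "x \<in> carrier G" "y \<in> carrier G" "x \<noteq> y"
  shows "\<not> is_MDTS G {x, y}"
  using pair_coincidences[OF assms(1,2)]
  by (auto simp: is_MDTS_def card_sum_set_pair[OF assms] card_diff_set_pair[OF assms])

lemma num_MDTS_2: "num_MDTS G 2 = 0"
proof -
  have none: "{A. A \<subseteq> carrier G \<and> card A = 2 \<and> is_MDTS G A} = {}"
    using not_is_MDTS_pair by (auto simp: card_2_iff)
  show ?thesis unfolding num_MDTS_def none by simp
qed

lemma num_MSTD_plus_num_balanced_2:
  assumes "finite (carrier G)"
  shows "num_MSTD G 2 + num_balanced G 2 = card (carrier G) choose 2"
proof -
  let ?S = "{A. A \<subseteq> carrier G \<and> card A = 2 \<and> is_MSTD G A}"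
  let ?B = "{A. A \<subseteq> carrier G \<and> card A = 2 \<and> is_balanced G A}"
  have "is_MSTD G A \<or> is_balanced G A" if "A \<subseteq> carrier G" "card A = 2" for A
  proof -
    have "\<not> is_MDTS G A" using that not_is_MDTS_pair by (auto simp: card_2_iff)
    then show ?thesis by (auto simp: is_MSTD_def is_balanced_def is_MDTS_def)
  qed
  then have "?S \<union> ?B = {A. A \<subseteq> carrier G \<and> card A = 2}" by blast
  moreover have "?S \<inter> ?B = {}" by (auto simp: is_MSTD_def is_balanced_def)
  moreover have "finite ?S" "finite ?B"
    using assms by (auto intro: finite_subset[of _ "Pow (carrier G)"])
  ultimately have "card ?S + card ?B = card {A. A \<subseteq> carrier G \<and> card A = 2}"
    by (metis (no_types, lifting) card_Un_disjoint)
  then show ?thesis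
    using assms by (simp add: num_MSTD_def num_balanced_def n_subsets)
qed

end

section \<open>Pairs in a group with the dicyclic normal form\<close>

text \<open>The multiplication table of the dicyclic group in terms of the normal forms \<open>a\<^sup>i\<close>, \<open>a\<^sup>i b\<close>.
  Besides the relations it records that \<open>a\<close> has order exactly \<open>2 n\<close> and that \<open>b\<close> is not a power
  of \<open>a\<close>; these two conditions cannot be read off a presentation and make the \<open>4 n\<close> normal forms
  distinct. Exponents are integers so that \<open>b a\<^sup>i = a\<^sup>-\<^sup>i b\<close> can be stated.\<close>

locale dicyclic = group G for G (structure) +
  fixes n :: nat and a b
  assumes n_pos: "n > 0"
    and a [simp]: "a \<in> carrier G" and b [simp]: "b \<in> carrier G"
    and b_sq: "b \<otimes> b = a [^] int n"
    and b_a: "\<And>i :: int. b \<otimes> a [^] i = a [^] (- i) \<otimes> b"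
    and a_pow_eq_one_iff: "\<And>i :: int. a [^] i = \<one> \<longleftrightarrow> 2 * int n dvd i"
    and b_not_pow: "\<And>i :: int. b \<noteq> a [^] i"
    and carrier_eq: "carrier G = (\<Union>i :: int. {a [^] i, a [^] i \<otimes> b})"
begin

lemma a_pow_eq_iff: "a [^] i = a [^] j \<longleftrightarrow> 2 * int n dvd i - j" for i j :: int
proof -
  have "a [^] i = a [^] j \<longleftrightarrow> a [^] (i - j) = \<one>"
    by (metis a int_pow_closed int_pow_diff inv_equality inv_inv inv_closed r_inv)
  then show ?thesis by (simp add: a_pow_eq_one_iff)
qed

lemma a_pow_mod: "a [^] (i mod (2 * int n)) = a [^] i" for i :: int
  unfolding a_pow_eq_iff by (metis mod_eq_dvd_iff mod_mod_trivial)

lemma a_pow_neq: "a [^] i \<noteq> a [^] j \<otimes> b" for i j :: int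
proof
  assume "a [^] i = a [^] j \<otimes> b"
  then have "a [^] (- j) \<otimes> a [^] i = a [^] (- j) \<otimes> a [^] j \<otimes> b"
    by (simp add: m_assoc)
  then have "b = a [^] (i - j)"
    by (simp add: int_pow_mult[symmetric])
  then show False using b_not_pow by blast
qed

lemma inj_on_a_pow: "inj_on (\<lambda>i. a [^] i) {0..<2 * int n}"
proof (rule inj_onI)
  fix i j assume "i \<in> {0..<2 * int n}" "j \<in> {0..<2 * int n}" "a [^] i = a [^] j"
  then show "i = j" 
    by (metis a_pow_eq_iff atLeastLessThan_iff mod_eq_dvd_iff mod_pos_pos_trivial)
qed

lemma carrier_eq_image:
  "carrier G = (\<lambda>i. a [^] i) ` {0..<2 * int n} \<union> (\<lambda>i. a [^] i \<otimes> b) ` {0..<2 * int n}"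
proof -
  have "i mod (2 * int n) \<in> {0..<2 * int n}" for i using n_pos by simp
  then have "a [^] i \<in> (\<lambda>i. a [^] i) ` {0..<2 * int n}"
    "a [^] i \<otimes> b \<in> (\<lambda>i. a [^] i \<otimes> b) ` {0..<2 * int n}" for i :: int
    using a_pow_mod[of i] by (metis image_eqI)+
  then show ?thesis unfolding carrier_eq by blast
qed

lemma finite_carrier: "finite (carrier G)"
  unfolding carrier_eq_image by simp

lemma card_carrier: "card (carrier G) = 4 * n"
proof -
  have "inj_on (\<lambda>i. a [^] i \<otimes> b) {0..<2 * int n}"
    using inj_on_a_pow by (auto simp: inj_on_def)
  then show ?thesis
    unfolding carrier_eq_image using a_pow_neq
    by (subst card_Un_disjoint) (auto simp: card_image inj_on_a_pow)
qed

text \<open>Moving the first \<open>b\<close> across \<open>a\<^sup>j\<close> cancels both powers of \<open>a\<close> and leaves \<open>b b\<close>.\<close>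

lemma a_pow_b_sq: "(a [^] j \<otimes> b) \<otimes> (a [^] j \<otimes> b) = a [^] int n" for j :: int
proof -
  have "(a [^] j \<otimes> b) \<otimes> (a [^] j \<otimes> b) = a [^] j \<otimes> (b \<otimes> a [^] j) \<otimes> b"
    by (simp add: m_assoc)
  also have "\<dots> = (a [^] j \<otimes> a [^] (- j)) \<otimes> (b \<otimes> b)"
    by (simp only: b_a) (simp add: m_assoc)
  finally show ?thesis by (simp add: int_pow_mult[symmetric] b_sq)
qed

lemma a_pow_sq_eq_iff:
  "a [^] i \<otimes> a [^] i = (a [^] j \<otimes> b) \<otimes> (a [^] j \<otimes> b) \<longleftrightarrow> 2 * int n dvd 2 * i - int n"
  for i j :: int
  by (simp only: a_pow_b_sq int_pow_mult[OF a, symmetric] a_pow_eq_iff mult_2)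

text \<open>The products in the two orders are \<open>a\<^sup>j\<^sup>+\<^sup>i b\<close> and \<open>a\<^sup>j\<^sup>-\<^sup>i b\<close>.\<close>

lemma a_pow_commutes_iff:
  "a [^] i \<otimes> (a [^] j \<otimes> b) = (a [^] j \<otimes> b) \<otimes> a [^] i \<longleftrightarrow> int n dvd i"
  for i j :: int
proof -
  have "(a [^] j \<otimes> b) \<otimes> a [^] i = a [^] j \<otimes> (b \<otimes> a [^] i)" by (simp add: m_assoc)
  also have "\<dots> = a [^] (j - i) \<otimes> b"
    by (simp only: b_a) (simp add: int_pow_mult[symmetric] flip: m_assoc)
  finally have "a [^] i \<otimes> (a [^] j \<otimes> b) = (a [^] j \<otimes> b) \<otimes> a [^] i
      \<longleftrightarrow> a [^] (i + j) \<otimes> b = a [^] (j - i) \<otimes> b"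
    by (simp add: int_pow_mult flip: m_assoc)
  also have "\<dots> \<longleftrightarrow> 2 * int n dvd 2 * i"
    by (simp add: a_pow_eq_iff)
  finally show ?thesis by simp
qed

text \<open>Whether \<open>{a\<^sup>i, a\<^sup>j b}\<close> is MSTD depends on \<open>i\<close> alone; these are the reduced exponents \<open>i\<close>
  for which it is.\<close>

definition MSTD_exponents :: "int set" where
  "MSTD_exponents = {i \<in> {0..<2 * int n}. \<not> int n dvd i \<and> \<not> 2 * int n dvd 2 * i - int n}"

lemma is_MSTD_mixed_pair_iff:
  "is_MSTD G {a [^] i, a [^] j \<otimes> b} \<longleftrightarrow> \<not> int n dvd i \<and> \<not> 2 * int n dvd 2 * i - int n"
  for i j :: int
  using is_MSTD_pair_iff[OF _ _ a_pow_neq, of i j]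
  unfolding a_pow_commutes_iff a_pow_sq_eq_iff by simp

lemma not_is_MSTD_same_kind:
  fixes i j :: int
  shows "a [^] i \<noteq> a [^] j \<Longrightarrow> \<not> is_MSTD G {a [^] i, a [^] j}"
    and "a [^] i \<otimes> b \<noteq> a [^] j \<otimes> b \<Longrightarrow> \<not> is_MSTD G {a [^] i \<otimes> b, a [^] j \<otimes> b}"
proof -
  have "a [^] i \<otimes> a [^] j = a [^] j \<otimes> a [^] i"
    by (simp add: int_pow_mult[symmetric] add.commute)
  then show "a [^] i \<noteq> a [^] j \<Longrightarrow> \<not> is_MSTD G {a [^] i, a [^] j}"
    by (simp add: is_MSTD_pair_iff)
  show "a [^] i \<otimes> b \<noteq> a [^] j \<otimes> b \<Longrightarrow> \<not> is_MSTD G {a [^] i \<otimes> b, a [^] j \<otimes> b}"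
    using a_pow_b_sq by (subst is_MSTD_pair_iff) simp_all
qed

text \<open>A mixed pair determines its two exponents modulo \<open>2 n\<close>, because a power of \<open>a\<close> never has the
  form \<open>a\<^sup>j b\<close>.\<close>

lemma num_MSTD_2_eq: "num_MSTD G 2 = card MSTD_exponents * (2 * n)"
proof -
  let ?f = "\<lambda>(i :: int, j :: int). {a [^] i, a [^] j \<otimes> b}"
  let ?D = "MSTD_exponents \<times> {0..<2 * int n}"
  have "inj_on ?f ?D"
  proof (rule inj_onI, clarify)
    fix i j k l
    assume "i \<in> MSTD_exponents" "k \<in> MSTD_exponents"
      and jl: "j \<in> {0..<2 * int n}" "l \<in> {0..<2 * int n}"
      and "{a [^] i, a [^] j \<otimes> b} = {a [^] k, a [^] l \<otimes> b}"
    then have ik: "i \<in> {0..<2 * int n}" "k \<in> {0..<2 * int n}"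
      and "a [^] i = a [^] k" "a [^] j \<otimes> b = a [^] l \<otimes> b"
      using a_pow_neq by (auto simp: MSTD_exponents_def doubleton_eq_iff)
    then show "i = k \<and> j = l"
      using jl inj_on_a_pow by (auto dest: inj_onD)
  qed
  moreover have "{A. A \<subseteq> carrier G \<and> card A = 2 \<and> is_MSTD G A} = ?f ` ?D"
  proof (intro equalityI subsetI)
    fix A assume "A \<in> {A. A \<subseteq> carrier G \<and> card A = 2 \<and> is_MSTD G A}"
    then obtain x y where A: "A = {x, y}" "x \<noteq> y" "is_MSTD G {x, y}"
      and xy: "x \<in> carrier G" "y \<in> carrier G"
      by (auto simp: card_2_iff)
    have "\<exists>i\<in>{0..<2 * int n}. \<exists>j\<in>{0..<2 * int n}. A = {a [^] i, a [^] j \<otimes> b}"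
      using xy unfolding carrier_eq_image
    proof (elim UnE imageE)
      fix i j :: int assume "x = a [^] i" "y = a [^] j"
      then show ?thesis using A not_is_MSTD_same_kind(1) by blast
    next
      fix i j :: int assume "x = a [^] i \<otimes> b" "y = a [^] j \<otimes> b"
      then show ?thesis using A not_is_MSTD_same_kind(2) by blast
    next
      fix i j :: int assume "x = a [^] i \<otimes> b" "y = a [^] j"
        and ij: "i \<in> {0..<2 * int n}" "j \<in> {0..<2 * int n}"
      then have "A = {a [^] j, a [^] i \<otimes> b}" using A(1) by blast
      then show ?thesis using ij by blast
    qed (use A(1) in blast)
    then obtain i j where ij: "i \<in> {0..<2 * int n}" "j \<in> {0..<2 * int n}"
      and "A = {a [^] i, a [^] j \<otimes> b}"
      by blast
    moreover from this have "i \<in> MSTD_exponents"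
      using A is_MSTD_mixed_pair_iff[of i j] by (simp add: MSTD_exponents_def)
    ultimately show "A \<in> ?f ` ?D" by auto
  next
    fix A assume "A \<in> ?f ` ?D"
    then show "A \<in> {A. A \<subseteq> carrier G \<and> card A = 2 \<and> is_MSTD G A}"
      using a_pow_neq by (auto simp: MSTD_exponents_def is_MSTD_mixed_pair_iff)
  qed
  ultimately show ?thesis
    by (simp add: num_MSTD_def card_image card_cartesian_product nat_mult_distrib)
qed

lemma card_MSTD_exponents:
  assumes "n \<ge> 2"
  shows "card MSTD_exponents = (if even n then 2 * n - 4 else 2 * n - 2)"
proof -
  have dvd1: "int n dvd i \<longleftrightarrow> i \<in> {0, int n}" if "i \<in> {0..<2 * int n}" for i
  proof
    assume "int n dvd i"
    then obtain k where k: "i = int n * k" by blast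
    have "0 \<le> i" "i < 2 * int n" using that by auto
    then have "int n * 0 \<le> int n * k" "int n * k < int n * 2" unfolding k by linarith+
    then have "0 \<le> k" "k < 2"
      unfolding mult_le_cancel_left mult_less_cancel_left using n_pos by auto
    then have "k = 0 \<or> k = 1" by auto
    then show "i \<in> {0, int n}" using k by auto
  qed auto
  have dvd2: "2 * int n dvd 2 * i - int n \<longleftrightarrow> 2 * i = int n \<or> 2 * i = 3 * int n"
    if "i \<in> {0..<2 * int n}" for i
  proof
    assume "2 * int n dvd 2 * i - int n"
    then obtain k where k: "2 * i - int n = int n * (2 * k)" by (metis dvdE mult.assoc mult.commute)
    have "0 \<le> i" "i < 2 * int n" using that by auto
    then have "int n * (- 1) \<le> int n * (2 * k)" "int n * (2 * k) < int n * 3"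
      unfolding k[symmetric] by linarith+
    then have "- 1 \<le> 2 * k" "2 * k < 3"
      unfolding mult_le_cancel_left mult_less_cancel_left using n_pos by auto
    then have "k = 0 \<or> k = 1" by auto
    then show "2 * i = int n \<or> 2 * i = 3 * int n" using k by auto
  qed auto
  show ?thesis
  proof (cases "even n")
    case True
    then obtain m where m: "n = 2 * m" by blast
    have "MSTD_exponents = {0..<2 * int n} - {0, int m, 2 * int m, 3 * int m}"
      unfolding MSTD_exponents_def using dvd1 dvd2 by (auto simp: m)
    moreover have "card {0, int m, 2 * int m, 3 * int m} = 4"
      using m assms by auto
    moreover have "{0, int m, 2 * int m, 3 * int m} \<subseteq> {0..<2 * int n}" using m assms by auto
    ultimately show ?thesis using True by (simp add: card_Diff_subset)
  next
    case False
    then have odd: "2 * i \<noteq> int n" "2 * i \<noteq> 3 * int n" for i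
      by presburger+
    have "MSTD_exponents = {0..<2 * int n} - {0, int n}"
      unfolding MSTD_exponents_def using dvd1 dvd2 odd by auto
    moreover have "{0, int n} \<subseteq> {0..<2 * int n}" using n_pos by auto
    ultimately show ?thesis using False n_pos by (simp add: card_Diff_subset)
  qed
qed

end

section \<open>The dicyclic normal form in the presented group\<close>

text \<open>The pair \<open>(i, s)\<close> stands for \<open>a\<^sup>i b\<close> if \<open>s\<close> holds and for \<open>a\<^sup>i\<close> otherwise, and a letter acts
  as left multiplication should: \<open>b a\<^sup>i = a\<^sup>-\<^sup>i b\<close> and \<open>b a\<^sup>i b = a\<^sup>n\<^sup>-\<^sup>i\<close>. The exponents are not
  reduced modulo \<open>2 n\<close>. Then a letter and its inverse act by inverse maps on the nose, and only
  the defining relations have to be checked up to the congruence \<open>dic_cong\<close>.\<close>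

fun letter_act :: "nat \<Rightarrow> dic_gen letter \<Rightarrow> int \<times> bool \<Rightarrow> int \<times> bool" where
  "letter_act n (Gen dic_a) (i, s) = (i + 1, s)"
| "letter_act n (GenInv dic_a) (i, s) = (i - 1, s)"
| "letter_act n (Gen dic_b) (i, s) = (if s then (int n - i, False) else (- i, True))"
| "letter_act n (GenInv dic_b) (i, s) = (if s then (- i, False) else (int n - i, True))"

definition word_act :: "nat \<Rightarrow> dic_gen word \<Rightarrow> int \<times> bool \<Rightarrow> int \<times> bool" where
  "word_act n = foldr (letter_act n)"

definition dic_cong :: "nat \<Rightarrow> int \<times> bool \<Rightarrow> int \<times> bool \<Rightarrow> bool" where
  "dic_cong n p q \<longleftrightarrow> 2 * int n dvd fst p - fst q \<and> snd p = snd q"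

lemma dic_cong_refl: "dic_cong n p p"
  by (simp add: dic_cong_def)

lemma dic_cong_sym: "dic_cong n p q \<Longrightarrow> dic_cong n q p"
  by (auto simp: dic_cong_def dvd_diff_commute)

lemma dic_cong_trans: "dic_cong n p q \<Longrightarrow> dic_cong n q r \<Longrightarrow> dic_cong n p r"
  using dvd_add[of "2 * int n" "fst p - fst q" "fst q - fst r"] by (auto simp: dic_cong_def)

lemma word_act_append: "word_act n (u @ v) p = word_act n u (word_act n v p)"
  by (simp add: word_act_def)

lemma word_act_replicate_a: "word_act n (replicate k (Gen dic_a)) (i, s) = (i + int k, s)"
  by (induction k) (auto simp: word_act_def)

lemma letter_act_cong:
  assumes "dic_cong n p q"
  shows "dic_cong n (letter_act n l p) (letter_act n l q)"
proof -
  obtain i s j where [simp]: "p = (i, s)" "q = (j, s)" and ij: "2 * int n dvd i - j"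
    using assms by (cases p, cases q) (auto simp: dic_cong_def)
  have "2 * int n dvd j - i" using ij by (simp add: dvd_diff_commute)
  with ij show ?thesis
    by (cases "(n, l, p)" rule: letter_act.cases) (auto simp: dic_cong_def)
qed

lemma word_act_cong: "dic_cong n p q \<Longrightarrow> dic_cong n (word_act n u p) (word_act n u q)"
  by (induction u) (auto simp: word_act_def letter_act_cong)

text \<open>Up to congruence the action of words descends to the presented group; it is its regular
  representation. This is the one source of inequalities between elements of that group.\<close>

lemma pres_eq_imp_word_act_cong:
  assumes "pres_eq (dicyclic_relations n) u v"
  shows "dic_cong n (word_act n u p) (word_act n v p)"
  using assms
proof (induction arbitrary: p)
  case (rel u v)
  obtain i s where "p = (i, s)" by (cases p)
  with rel show ?case
    by (auto simp: dicyclic_relations_def word_act_replicate_a)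
      (auto simp: word_act_def dic_cong_def)
next
  case (cancel l)
  show ?case
    by (cases "(n, l, p)" rule: letter_act.cases) (auto simp: word_act_def dic_cong_def)
next
  case (append u u' v v')
  then show ?case
    by (metis dic_cong_trans word_act_append word_act_cong)
qed (blast intro: dic_cong_refl dic_cong_sym dic_cong_trans)+

text \<open>That \<open>a\<close> has order \<open>2 n\<close> and that \<open>b\<close> is no power of \<open>a\<close> follows by letting words act on the
  base point \<open>(0, False)\<close>, which stands for \<open>1\<close>. That the normal forms exhaust the group follows
  since they contain \<open>1\<close> and are stable under left multiplication by every letter.\<close>

lemma dicyclic_dicyclic_group:
  assumes "n > 0"
  defines "R \<equiv> dicyclic_relations n"
  shows "dicyclic (dicyclic_group n) n (word_class R [Gen dic_a]) (word_class R [Gen dic_b])"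
proof -
  define G where "G = dicyclic_group n"
  define a where "a = word_class R [Gen dic_a]"
  define b where "b = word_class R [Gen dic_b]"
  interpret group G
    by (simp add: G_def dicyclic_group_def group_presented_group)
  have carrier: "carrier G = range (word_class R)" and one: "\<one>\<^bsub>G\<^esub> = word_class R []"
    by (simp_all add: G_def dicyclic_group_def presented_group_def R_def)
  have mult: "word_class R u \<otimes>\<^bsub>G\<^esub> word_class R v = word_class R (u @ v)" for u v
    by (simp add: G_def dicyclic_group_def mult_word_class R_def)
  have a [simp]: "a \<in> carrier G" and b [simp]: "b \<in> carrier G"
    by (simp_all add: carrier a_def b_def)
  have pow: "a [^]\<^bsub>G\<^esub> k = word_class R (replicate k (Gen dic_a))" for k :: nat
    by (induction k) (simp_all add: one a_def mult replicate_append_same)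
  have gen_inv: "word_class R [GenInv g] = inv\<^bsub>G\<^esub> (word_class R [Gen g])" for g
  proof (rule inv_equality[symmetric])
    show "word_class R [GenInv g] \<otimes>\<^bsub>G\<^esub> word_class R [Gen g] = \<one>\<^bsub>G\<^esub>"
      using pres_eq.cancel[of R "GenInv g"] by (simp add: mult one word_class_eq_iff)
  qed (simp_all add: carrier)
  have rel: "word_class R u = word_class R v" if "(u, v) \<in> R" for u v
    using that by (simp add: word_class_eq_iff pres_eq.rel)
  have a_2n: "a [^]\<^bsub>G\<^esub> (2 * int n) = \<one>\<^bsub>G\<^esub>"
  proof -
    have "a [^]\<^bsub>G\<^esub> (2 * n) = \<one>\<^bsub>G\<^esub>"
      unfolding pow one by (rule rel) (simp add: R_def dicyclic_relations_def)
    then show ?thesis by (metis int_pow_int of_nat_mult of_nat_numeral)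
  qed
  have bb: "b \<otimes>\<^bsub>G\<^esub> b = a [^]\<^bsub>G\<^esub> int n"
    unfolding int_pow_int pow b_def mult
    by (rule rel[symmetric]) (simp add: R_def dicyclic_relations_def)
  have "inv\<^bsub>G\<^esub> b \<otimes>\<^bsub>G\<^esub> a \<otimes>\<^bsub>G\<^esub> b = inv\<^bsub>G\<^esub> a"
    unfolding a_def b_def gen_inv[symmetric] mult
    by (simp, rule rel) (simp add: R_def dicyclic_relations_def)
  then have a_b: "a \<otimes>\<^bsub>G\<^esub> b = b \<otimes>\<^bsub>G\<^esub> inv\<^bsub>G\<^esub> a"
    by (metis a b inv_closed inv_solve_left m_assoc m_closed)
  have b_inv_a: "b \<otimes>\<^bsub>G\<^esub> a = inv\<^bsub>G\<^esub> a \<otimes>\<^bsub>G\<^esub> b"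
    by (metis a b a_b inv_closed inv_solve_left inv_solve_right m_assoc m_closed)
  have b_nat: "b \<otimes>\<^bsub>G\<^esub> a [^]\<^bsub>G\<^esub> k = inv\<^bsub>G\<^esub> a [^]\<^bsub>G\<^esub> k \<otimes>\<^bsub>G\<^esub> b" for k :: nat
  proof (induction k)
    case (Suc k)
    then show ?case
      by (simp add: b_inv_a m_assoc flip: m_assoc[of b])
  qed simp
  \<comment> \<open>Words are easily written down for natural exponents only, so integer exponents are reduced
    to natural ones by means of \<open>a\<^sup>2\<^sup>n = 1\<close>.\<close>
  have a_pow_mod: "a [^]\<^bsub>G\<^esub> i = a [^]\<^bsub>G\<^esub> nat (i mod (2 * int n))" for i :: int
  proof -
    have "a [^]\<^bsub>G\<^esub> (2 * int n * (i div (2 * int n))) = \<one>\<^bsub>G\<^esub>"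
      by (metis a a_2n int_pow_one int_pow_pow)
    then have "a [^]\<^bsub>G\<^esub> (2 * int n * (i div (2 * int n)) + i mod (2 * int n))
        = a [^]\<^bsub>G\<^esub> (i mod (2 * int n))"
      unfolding int_pow_mult[OF a] by simp
    then have "a [^]\<^bsub>G\<^esub> i = a [^]\<^bsub>G\<^esub> (i mod (2 * int n))" by simp
    also have "\<dots> = a [^]\<^bsub>G\<^esub> nat (i mod (2 * int n))"
      using assms by (simp add: pow_nat)
    finally show ?thesis .
  qed
  have b_a: "b \<otimes>\<^bsub>G\<^esub> a [^]\<^bsub>G\<^esub> i = a [^]\<^bsub>G\<^esub> (- i) \<otimes>\<^bsub>G\<^esub> b" for i :: int
  proof -
    define k where "k = nat (i mod (2 * int n))"
    have i: "a [^]\<^bsub>G\<^esub> i = a [^]\<^bsub>G\<^esub> k" by (simp add: k_def flip: a_pow_mod)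
    then show ?thesis
      by (simp add: b_nat int_pow_neg nat_pow_inv)
  qed
  have act: "dic_cong n (word_act n u (0, False)) (word_act n v (0, False))"
    if "word_class R u = word_class R v" for u v
    using that pres_eq_imp_word_act_cong by (simp add: word_class_eq_iff R_def)
  have pow_one: "a [^]\<^bsub>G\<^esub> i = \<one>\<^bsub>G\<^esub> \<longleftrightarrow> 2 * int n dvd i" for i :: int
  proof
    assume "a [^]\<^bsub>G\<^esub> i = \<one>\<^bsub>G\<^esub>"
    then have "dic_cong n (int (nat (i mod (2 * int n))), False) (0, False)"
      using act unfolding a_pow_mod[of i] pow one
      by (metis add_0 word_act_replicate_a replicate_0 of_nat_0)
    then have "2 * int n dvd i mod (2 * int n)"
      using assms by (simp add: dic_cong_def)
    then show "2 * int n dvd i" by (simp add: dvd_mod_iff)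
  next
    assume "2 * int n dvd i"
    then show "a [^]\<^bsub>G\<^esub> i = \<one>\<^bsub>G\<^esub>" by (simp add: a_pow_mod[of i])
  qed
  have not_pow: "b \<noteq> a [^]\<^bsub>G\<^esub> i" for i :: int
  proof
    assume "b = a [^]\<^bsub>G\<^esub> i"
    then have "dic_cong n (word_act n [Gen dic_b] (0, False))
      (word_act n (replicate (nat (i mod (2 * int n))) (Gen dic_a)) (0, False))"
      by (intro act) (simp add: b_def a_pow_mod[of i] pow)
    then show False
      unfolding word_act_replicate_a by (simp add: word_act_def dic_cong_def)
  qed
  define N where "N = (\<Union>i :: int. {a [^]\<^bsub>G\<^esub> i, a [^]\<^bsub>G\<^esub> i \<otimes>\<^bsub>G\<^esub> b})"
  have N_intros: "a [^]\<^bsub>G\<^esub> i \<in> N" "a [^]\<^bsub>G\<^esub> i \<otimes>\<^bsub>G\<^esub> b \<in> N" for i :: int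
    by (auto simp: N_def)
  have N_carrier: "N \<subseteq> carrier G" by (auto simp: N_def)
  have a_N: "a [^]\<^bsub>G\<^esub> j \<otimes>\<^bsub>G\<^esub> x \<in> N" if "x \<in> N" for x and j :: int
    using that N_intros by (auto simp: N_def int_pow_mult simp flip: m_assoc int_pow_mult)
  have b_N: "b \<otimes>\<^bsub>G\<^esub> x \<in> N" if "x \<in> N" for x
  proof -
    from that obtain i :: int where "x = a [^]\<^bsub>G\<^esub> i \<or> x = a [^]\<^bsub>G\<^esub> i \<otimes>\<^bsub>G\<^esub> b"
      by (auto simp: N_def)
    moreover have "b \<otimes>\<^bsub>G\<^esub> (a [^]\<^bsub>G\<^esub> i \<otimes>\<^bsub>G\<^esub> b) = a [^]\<^bsub>G\<^esub> (- i + int n)"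
    proof -
      have "b \<otimes>\<^bsub>G\<^esub> (a [^]\<^bsub>G\<^esub> i \<otimes>\<^bsub>G\<^esub> b) = (b \<otimes>\<^bsub>G\<^esub> a [^]\<^bsub>G\<^esub> i) \<otimes>\<^bsub>G\<^esub> b" by (simp add: m_assoc)
      also have "\<dots> = a [^]\<^bsub>G\<^esub> (- i) \<otimes>\<^bsub>G\<^esub> (b \<otimes>\<^bsub>G\<^esub> b)" by (simp only: b_a) (simp add: m_assoc)
      finally show ?thesis by (simp only: bb int_pow_mult[OF a])
    qed
    ultimately show ?thesis using N_intros b_a by metis
  qed
  have inv_b: "inv\<^bsub>G\<^esub> b = a [^]\<^bsub>G\<^esub> (- int n) \<otimes>\<^bsub>G\<^esub> b"
    by (rule inv_equality) (simp_all add: m_assoc bb flip: int_pow_mult)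
  have "word_class R w \<in> N" for w
  proof (induction w)
    case Nil
    then show ?case using N_intros(1)[of 0] by (simp add: one)
  next
    case (Cons l w)
    have "word_class R [l] \<otimes>\<^bsub>G\<^esub> word_class R w \<in> N"
    proof (cases l)
      case (Gen g)
      then show ?thesis
        using Cons a_N[of _ 1] b_N
        by (cases g) (auto simp flip: a_def b_def)
    next
      case (GenInv g)
      have "inv\<^bsub>G\<^esub> a \<otimes>\<^bsub>G\<^esub> word_class R w \<in> N"
        using Cons a_N[of _ "- 1"] by (simp add: int_pow_neg)
      moreover have "inv\<^bsub>G\<^esub> b \<otimes>\<^bsub>G\<^esub> word_class R w \<in> N"
        using Cons a_N b_N N_carrier by (auto simp: inv_b m_assoc)
      ultimately show ?thesis
        unfolding GenInv gen_inv by (cases g) (auto simp flip: a_def b_def)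
    qed
    then show ?case by (simp add: mult)
  qed
  then have "carrier G = N" using N_carrier by (auto simp: carrier)
  then have "dicyclic G n a b"
    unfolding N_def
    by (intro dicyclic.intro dicyclic_axioms.intro group_axioms assms(1) a b bb b_a pow_one not_pow)
  then show ?thesis by (simp add: G_def a_def b_def)
qed

section \<open>The counts\<close>

theorem theorem1p4:
  fixes n :: nat
  assumes "n \<ge> 2"
  shows "(even n \<longrightarrow>
            num_MSTD (dicyclic_group n) 2 = 4 * n * (n - 2) \<and>
            num_MDTS (dicyclic_group n) 2 = 0 \<and>
            num_balanced (dicyclic_group n) 2 = 2 * n * (2 * n + 3)) \<and>
         (odd n \<longrightarrow>
            num_MSTD (dicyclic_group n) 2 = 4 * n * (n - 1) \<and>
            num_MDTS (dicyclic_group n) 2 = 0 \<and>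
            num_balanced (dicyclic_group n) 2 = 2 * n * (2 * n + 1))"
proof -
  let ?R = "dicyclic_relations n"
  interpret dicyclic "dicyclic_group n" n "word_class ?R [Gen dic_a]" "word_class ?R [Gen dic_b]"
    using assms by (intro dicyclic_dicyclic_group) simp
  \<comment> \<open>This substitution removes the truncated subtractions \<open>n - 1\<close> and \<open>n - 2\<close>.\<close>
  obtain m where m: "n = m + 2" using assms by (metis le_add_diff_inverse2)
  have "(4 * n) choose 2 = 2 * n * (4 * n - 1)"
    by (simp add: choose_two)
  then have total: "num_MSTD (dicyclic_group n) 2 + num_balanced (dicyclic_group n) 2
      = 2 * n * (4 * n - 1)"
    using num_MSTD_plus_num_balanced_2[OF finite_carrier] card_carrier by simp
  have mstd: "num_MSTD (dicyclic_group n) 2 = (if even n then 4 * n * (n - 2) else 4 * n * (n - 1))"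
    unfolding num_MSTD_2_eq card_MSTD_exponents[OF assms] by (simp add: m algebra_simps)
  with total have "even n \<Longrightarrow> num_balanced (dicyclic_group n) 2 = 2 * n * (2 * n + 3)"
    "odd n \<Longrightarrow> num_balanced (dicyclic_group n) 2 = 2 * n * (2 * n + 1)"
    by (simp_all add: m algebra_simps)
  with mstd show ?thesis by (simp add: num_MDTS_2)
qed

end
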